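(* For every positive integer $m$ and every integer $n\geq 2$, the cylinder $C(2m,2n)$ is interval colorable and $W(C(2m,2n))\geq 4m+2n-2$. For all positive integers $m,n$, the cylinder $C(2m,2n+1)$ is interval colorable and $W(C(2m,2n+1))\geq 4m+2n-1$.
   Context: All graphs are finite, undirected, without loops or multiple edges. An edge-coloring of a graph $G$ with colors $1,\ldots,t$ is an interval $t$-coloring if all $t$ colors are used, and the colors of the edges incident to each vertex are distinct and form an interval of consecutive integers. A graph is interval colorable if it has an interval $t$-coloring for some positive integer $t$; for such a graph, $W(G)$ is the greatest such $t$. The cylinder $C(a,b)$ is the Cartesian product $P_a\square C_b$ of the path on $a$ vertices and the cycle on $b$ vertices. The Cartesian product $G\square H$ has vertex set $V(G)\times V(H)$, with $(u_1,v_1)(u_2,v_2)$ an edge iff either $u_1=u_2$ and $v_1v_2\in E(H)$, or $v_1=v_2$ and $u_1u_2\in E(G)$. *)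

theory Defs
  imports Main
begin

record 'a ugraph =
  verts :: "'a set"
  edges :: "'a set set"

definition finite_simple_graph :: "'a ugraph \<Rightarrow> bool" where
  "finite_simple_graph G \<longleftrightarrow>
     finite (verts G) \<and>
     (\<forall>e \<in> edges G. \<exists>u \<in> verts G. \<exists>v \<in> verts G. u \<noteq> v \<and> e = {u, v})"

definition incident_edges :: "'a ugraph \<Rightarrow> 'a \<Rightarrow> 'a set set" where
  "incident_edges G v = {e \<in> edges G. v \<in> e}"

text \<open>An isolated vertex imposes no condition: its set of colors is an empty interval.\<close>

definition interval_coloring :: "'a ugraph \<Rightarrow> nat \<Rightarrow> ('a set \<Rightarrow> nat) \<Rightarrow> bool" where
  "interval_coloring G t c \<longleftrightarrow>
     c ` edges G = {1..t} \<and>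
     (\<forall>v \<in> verts G. inj_on c (incident_edges G v) \<and>
        (\<exists>a b. c ` incident_edges G v = {a..b}))"

definition interval_t_colorable :: "'a ugraph \<Rightarrow> nat \<Rightarrow> bool" where
  "interval_t_colorable G t \<longleftrightarrow> (\<exists>c. interval_coloring G t c)"

definition interval_colorable :: "'a ugraph \<Rightarrow> bool" where
  "interval_colorable G \<longleftrightarrow> (\<exists>t>0. interval_t_colorable G t)"

text \<open>This value is meaningful only for interval colorable finite graphs.\<close>

definition W :: "'a ugraph \<Rightarrow> nat" where
  "W G = (GREATEST t. t > 0 \<and> interval_t_colorable G t)"

definition path_graph :: "nat \<Rightarrow> nat ugraph" where
  "path_graph a = \<lparr>verts = {0..<a}, edges = {{i, i + 1} | i. i + 1 < a}\<rparr>"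

text \<open>The cycle on \<open>b\<close> vertices for \<open>b \<ge> 3\<close>; smaller \<open>b\<close> are degenerate.\<close>

definition cycle_graph :: "nat \<Rightarrow> nat ugraph" where
  "cycle_graph b = \<lparr>verts = {0..<b}, edges = {{i, (i + 1) mod b} | i. i < b}\<rparr>"

definition cartesian_product :: "'a ugraph \<Rightarrow> 'b ugraph \<Rightarrow> ('a \<times> 'b) ugraph" where
  "cartesian_product G H =
     \<lparr>verts = verts G \<times> verts H,
      edges = {{(u1, v1), (u2, v2)} | u1 v1 u2 v2.
        u1 \<in> verts G \<and> u2 \<in> verts G \<and> v1 \<in> verts H \<and> v2 \<in> verts H \<and>
        (u1 = u2 \<and> {v1, v2} \<in> edges H \<or> v1 = v2 \<and> {u1, u2} \<in> edges G)}\<rparr>"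

definition cylinder :: "nat \<Rightarrow> nat \<Rightarrow> (nat \<times> nat) ugraph" where
  "cylinder a b = cartesian_product (path_graph a) (cycle_graph b)"

lemma finite_simple_path_graph: "finite_simple_graph (path_graph a)"
proof -
  have "\<exists>u \<in> {0..<a}. \<exists>v \<in> {0..<a}. u \<noteq> v \<and> {i, i + 1} = {u, v}" if "i + 1 < a" for i
    by (rule bexI[of _ i], rule bexI[of _ "i + 1"]) (use that in simp_all)
  then show ?thesis
    unfolding finite_simple_graph_def path_graph_def by auto
qed

lemma finite_simple_cycle_graph:
  assumes "b \<ge> 3"
  shows "finite_simple_graph (cycle_graph b)"
proof -
  have "\<exists>u \<in> {0..<b}. \<exists>v \<in> {0..<b}. u \<noteq> v \<and> {i, (i + 1) mod b} = {u, v}"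
    if "i < b" for i
  proof (rule bexI[of _ i], rule bexI[of _ "(i + 1) mod b"])
    show "i \<noteq> (i + 1) mod b \<and> {i, (i + 1) mod b} = {i, (i + 1) mod b}"
      using that assms by (cases "i + 1 = b") auto
  qed (use that in simp_all)
  then show ?thesis
    unfolding finite_simple_graph_def cycle_graph_def by auto
qed

lemma finite_simple_cartesian_product:
  assumes "finite_simple_graph G" "finite_simple_graph H"
  shows "finite_simple_graph (cartesian_product G H)"
proof -
  have G: "u \<noteq> v" if "{u, v} \<in> edges G" for u v
    using assms(1) that unfolding finite_simple_graph_def by (metis doubleton_eq_iff)
  have H: "u \<noteq> v" if "{u, v} \<in> edges H" for u v
    using assms(2) that unfolding finite_simple_graph_def by (metis doubleton_eq_iff)
  have "\<exists>p \<in> verts G \<times> verts H. \<exists>q \<in> verts G \<times> verts H. p \<noteq> q \<and> e = {p, q}"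
    if e: "e \<in> edges (cartesian_product G H)" for e
  proof -
    from e obtain u1 v1 u2 v2 where
      "e = {(u1, v1), (u2, v2)}" "u1 \<in> verts G" "u2 \<in> verts G" "v1 \<in> verts H" "v2 \<in> verts H"
      "u1 = u2 \<and> {v1, v2} \<in> edges H \<or> v1 = v2 \<and> {u1, u2} \<in> edges G"
      unfolding cartesian_product_def by auto
    moreover from this have "(u1, v1) \<noteq> (u2, v2)" using G H by blast
    ultimately show ?thesis by blast
  qed
  moreover have "finite (verts (cartesian_product G H))"
    using assms by (simp add: finite_simple_graph_def cartesian_product_def)
  ultimately show ?thesis
    unfolding finite_simple_graph_def by (simp add: cartesian_product_def)
qed

lemma finite_simple_cylinder: "b \<ge> 3 \<Longrightarrow> finite_simple_graph (cylinder a b)"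
  unfolding cylinder_def
  by (intro finite_simple_cartesian_product finite_simple_path_graph finite_simple_cycle_graph)

lemma finite_edges:
  assumes "finite_simple_graph G"
  shows "finite (edges G)"
proof (rule finite_subset)
  show "edges G \<subseteq> Pow (verts G)"
  proof
    fix e assume "e \<in> edges G"
    then obtain u v where "u \<in> verts G" "v \<in> verts G" "e = {u, v}"
      using assms unfolding finite_simple_graph_def by meson
    then show "e \<in> Pow (verts G)" by simp
  qed
qed (use assms finite_simple_graph_def in auto)

lemma interval_t_colorable_le:
  assumes "finite_simple_graph G" "interval_t_colorable G t"
  shows "t \<le> card (edges G)"
proof -
  from assms(2) obtain c where "c ` edges G = {1..t}"
    unfolding interval_t_colorable_def interval_coloring_def by blast
  then show ?thesis
    using card_image_le[OF finite_edges[OF assms(1)], of c] by simp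
qed

lemma W_greatest:
  assumes "finite_simple_graph G" "interval_colorable G"
  shows "W G > 0" "interval_t_colorable G (W G)"
    "\<And>t. interval_t_colorable G t \<Longrightarrow> t \<le> W G"
proof -
  let ?P = "\<lambda>t. t > 0 \<and> interval_t_colorable G t"
  have b: "\<And>t. ?P t \<Longrightarrow> t \<le> card (edges G)"
    using interval_t_colorable_le[OF assms(1)] by blast
  obtain k where "?P k" using assms(2) unfolding interval_colorable_def by blast
  then have "?P (W G)" unfolding W_def by (rule GreatestI_nat[of ?P]) (use b in blast)
  then show "W G > 0" "interval_t_colorable G (W G)" by auto
  show "t \<le> W G" if "interval_t_colorable G t" for t
  proof (cases "t = 0")
    case False
    with that have "?P t" by simp
    then show ?thesis unfolding W_def by (rule Greatest_le_nat[of ?P]) (use b in blast)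
  qed simp
qed

end

theory Submission
  imports Defs
begin

text \<open>
  Give the edges of a cycle on \<open>b\<close> vertices, in cyclic order, the colors
  \<open>2, 4, 6, \<dots>, 7, 5, 3\<close>. Any two neighboring edges then differ by one or two, so at every vertex
  one further color completes an interval of length three; choosing \<open>1\<close> and \<open>b + 2\<close> at the two
  vertices where the difference is one, all of \<open>1, \<dots>, b + 2\<close> occur. Coloring both cycles of a
  prism in this way and each rung with the completing color gives the prism an interval
  \<open>(b + 2)\<close>-coloring in which both ends of a rung see the same interval \<open>{s..s + 2}\<close>. Stacking
  \<open>m\<close> such prisms, each shifted by \<open>4\<close> against the previous one, leaves exactly the color
  \<open>s + 3\<close> for the edge from one prism to the next. This uses \<open>b + 2 + 4 (m - 1)\<close> colors.
\<close>

section \<open>Edges of the cylinder and those at a vertex\<close>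

definition horizontal_edge :: "nat \<Rightarrow> nat \<Rightarrow> nat \<Rightarrow> (nat \<times> nat) set" where
  "horizontal_edge b r j = {(r, j), (r, (j + 1) mod b)}"

definition vertical_edge :: "nat \<Rightarrow> nat \<Rightarrow> (nat \<times> nat) set" where
  "vertical_edge r j = {(r, j), (r + 1, j)}"

text \<open>Since horizontal edge \<open>i\<close> leads from column \<open>i\<close> to its
  successor, this is the index of the other horizontal edge at column \<open>j\<close>.\<close>

definition cyclic_pred :: "nat \<Rightarrow> nat \<Rightarrow> nat" where
  "cyclic_pred b j = (if j = 0 then b - 1 else j - 1)"

lemma cyclic_pred_less: "j < b \<Longrightarrow> cyclic_pred b j < b"
  by (auto simp: cyclic_pred_def)

lemma cyclic_succ_eq_iff:
  assumes "i < b" "j < b"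
  shows "(i + 1) mod b = j \<longleftrightarrow> i = cyclic_pred b j"
  using assms by (cases "i + 1 = b") (auto simp: cyclic_pred_def)

lemma edges_cylinder:
  "edges (cylinder a b) =
    {horizontal_edge b r j | r j. r < a \<and> j < b} \<union> {vertical_edge r j | r j. r + 1 < a \<and> j < b}"
    (is "_ = ?H \<union> ?V")
proof (intro equalityI subsetI)
  fix e assume "e \<in> edges (cylinder a b)"
  then obtain u1 v1 u2 v2 where e: "e = {(u1, v1), (u2, v2)}"
    and verts: "u1 \<in> verts (path_graph a)" "v1 \<in> verts (cycle_graph b)"
    and adj: "u1 = u2 \<and> {v1, v2} \<in> edges (cycle_graph b) \<or>
      v1 = v2 \<and> {u1, u2} \<in> edges (path_graph a)"
    unfolding cylinder_def cartesian_product_def by auto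
  have "u1 < a" "v1 < b" using verts by (simp_all add: path_graph_def cycle_graph_def)
  from adj show "e \<in> ?H \<union> ?V"
  proof (elim disjE conjE)
    assume u: "u1 = u2" and "{v1, v2} \<in> edges (cycle_graph b)"
    then obtain i where i: "i < b" "{v1, v2} = {i, (i + 1) mod b}"
      by (auto simp: cycle_graph_def)
    \<comment> \<open>As an image of the unordered pair, \<open>e\<close> can be rewritten without
      distinguishing the two orientations of the cycle edge.\<close>
    have "e = Pair u1 ` {v1, v2}" using e u by auto
    also have "\<dots> = horizontal_edge b u1 i" unfolding i by (simp add: horizontal_edge_def)
    finally show ?thesis using i \<open>u1 < a\<close> by blast
  next
    assume v: "v1 = v2" and "{u1, u2} \<in> edges (path_graph a)"
    then obtain i where i: "i + 1 < a" "{u1, u2} = {i, i + 1}"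
      by (auto simp: path_graph_def)
    have "e = (\<lambda>u. (u, v1)) ` {u1, u2}" using e v by auto
    also have "\<dots> = vertical_edge i v1" unfolding i by (simp add: vertical_edge_def)
    finally show ?thesis using i \<open>v1 < b\<close> by blast
  qed
next
  fix e assume "e \<in> ?H \<union> ?V"
  then show "e \<in> edges (cylinder a b)"
  proof (elim UnE CollectE exE conjE)
    fix r j assume e: "e = horizontal_edge b r j" and "r < a" "j < b"
    then have "r \<in> verts (path_graph a)" "j \<in> verts (cycle_graph b)"
      "(j + 1) mod b \<in> verts (cycle_graph b)" "{j, (j + 1) mod b} \<in> edges (cycle_graph b)"
      by (auto simp: path_graph_def cycle_graph_def)
    then show ?thesis
      unfolding e cylinder_def cartesian_product_def horizontal_edge_def ugraph.simps by blast
  next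
    fix r j assume e: "e = vertical_edge r j" and "r + 1 < a" "j < b"
    then have "r \<in> verts (path_graph a)" "r + 1 \<in> verts (path_graph a)"
      "j \<in> verts (cycle_graph b)" "{r, r + 1} \<in> edges (path_graph a)"
      by (auto simp: path_graph_def cycle_graph_def)
    then show ?thesis
      unfolding e cylinder_def cartesian_product_def vertical_edge_def ugraph.simps by blast
  qed
qed

lemma incident_edges_cylinder:
  assumes "r < a" "j < b"
  shows "incident_edges (cylinder a b) (r, j) =
    {horizontal_edge b r (cyclic_pred b j), horizontal_edge b r j} \<union>
    (if r + 1 < a then {vertical_edge r j} else {}) \<union>
    (if r > 0 then {vertical_edge (r - 1) j} else {})"
    (is "_ = ?R")
proof (intro equalityI subsetI)
  fix e assume "e \<in> incident_edges (cylinder a b) (r, j)"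
  then have e: "e \<in> edges (cylinder a b)" "(r, j) \<in> e" by (auto simp: incident_edges_def)
  from e(1)[unfolded edges_cylinder] show "e \<in> ?R"
  proof (elim UnE CollectE exE conjE)
    fix r' i assume h: "e = horizontal_edge b r' i" "r' < a" "i < b"
    then have "r' = r" "i = j \<or> (i + 1) mod b = j"
      using e(2) by (auto simp: horizontal_edge_def)
    then show ?thesis using h cyclic_succ_eq_iff[OF \<open>i < b\<close> \<open>j < b\<close>] by auto
  next
    fix r' i assume v: "e = vertical_edge r' i" "r' + 1 < a" "i < b"
    then have "i = j" "r' = r \<or> r = r' + 1"
      using e(2) by (auto simp: vertical_edge_def)
    then show ?thesis using v by auto
  qed
next
  have p: "cyclic_pred b j < b" "(cyclic_pred b j + 1) mod b = j"
    using assms cyclic_pred_less cyclic_succ_eq_iff by auto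
  have "horizontal_edge b r (cyclic_pred b j) \<in> incident_edges (cylinder a b) (r, j)"
    using assms p unfolding incident_edges_def edges_cylinder by (auto simp: horizontal_edge_def)
  moreover have "horizontal_edge b r j \<in> incident_edges (cylinder a b) (r, j)"
    using assms unfolding incident_edges_def edges_cylinder by (auto simp: horizontal_edge_def)
  moreover have "vertical_edge r j \<in> incident_edges (cylinder a b) (r, j)" if "r + 1 < a"
    using assms that unfolding incident_edges_def edges_cylinder by (auto simp: vertical_edge_def)
  moreover have "vertical_edge (r - 1) j \<in> incident_edges (cylinder a b) (r, j)" if "r > 0"
  proof -
    have "r - 1 + 1 < a" using that assms by simp
    then have "vertical_edge (r - 1) j \<in> edges (cylinder a b)"
      using assms unfolding edges_cylinder by blast
    then show ?thesis using that by (simp add: incident_edges_def vertical_edge_def)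
  qed
  ultimately show "e \<in> incident_edges (cylinder a b) (r, j)" if "e \<in> ?R" for e
    using that by (auto split: if_splits)
qed

section \<open>Colors on a single prism\<close>

definition cycle_color :: "nat \<Rightarrow> nat \<Rightarrow> nat" where
  "cycle_color b j = (if 2 * j < b then 2 * j + 2 else 2 * (b - j) + 1)"

text \<open>For \<open>b \<ge> 3\<close>, the third branch catches exactly one column,
  \<open>b / 2\<close> rounded up, where the rising even colors of the cycle meet the falling odd
  ones.\<close>

definition rung_color :: "nat \<Rightarrow> nat \<Rightarrow> nat" where
  "rung_color b j =
    (if j = 0 then 1 else if 2 * j < b then 2 * j + 1
     else if 2 * j \<le> b + 1 then b + 2 else 2 * (b - j) + 2)"

text \<open>The least color \<open>s\<close> of the interval \<open>{s..s + 2}\<close> that a prism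
  shows at column \<open>j\<close>.\<close>

definition low_color :: "nat \<Rightarrow> nat \<Rightarrow> nat" where
  "low_color b j =
    (if j = 0 then 1 else if 2 * j < b then 2 * j
     else if 2 * j \<le> b + 1 then b else 2 * (b - j) + 1)"

text \<open>Away from the two meeting points of the even and the odd run, the cycle colors at a
  vertex differ by two and the rung fills the gap. At column 0 they are 3 and 2, and the rung goes
  below. At the other meeting point they are \<open>b\<close> and \<open>b + 1\<close>, in an order
  depending on the parity of \<open>b\<close>, and the rung goes above.\<close>

lemma prism_colors:
  assumes "b \<ge> 3" "j < b"
  defines "x \<equiv> cycle_color b (cyclic_pred b j)" and "y \<equiv> cycle_color b j"
    and "z \<equiv> rung_color b j" and "s \<equiv> low_color b j"
  shows "x \<noteq> y \<and> x \<noteq> z \<and> y \<noteq> z \<and> {x, y, z} = {s, s + 1, s + 2}"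
proof -
  consider "j = 0" | "j > 0" "2 * j < b" | "j > 0" "2 * j = b" | "2 * j = b + 1"
    | "2 * j > b + 1" by linarith
  then show ?thesis
    using assms(1,2) unfolding x_def y_def z_def s_def
      cycle_color_def rung_color_def low_color_def cyclic_pred_def
    by cases auto
qed

lemma low_color_bounds: "b \<ge> 3 \<Longrightarrow> j < b \<Longrightarrow> 1 \<le> low_color b j \<and> low_color b j \<le> b"
  by (auto simp: low_color_def)

text \<open>The extreme colors sit on the rungs at the two meeting points; the even colors in
  between come from the rising run, the odd ones from the falling run.\<close>

lemma prism_colors_surj:
  assumes "b \<ge> 3" "1 \<le> x" "x \<le> b + 2"
  shows "\<exists>j<b. cycle_color b j = x \<or> rung_color b j = x"
proof -
  consider "x = 1" | "x = b + 2" | "2 \<le> x" "x \<le> b + 1" "even x" | "2 \<le> x" "x \<le> b + 1" "odd x"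
    using assms by linarith
  then show ?thesis
  proof cases
    case 1
    then show ?thesis using assms by (intro exI[of _ 0]) (simp add: rung_color_def)
  next
    case 2
    then show ?thesis using assms
      by (intro exI[of _ "(b + 1) div 2"]) (auto simp: rung_color_def)
  next
    case 3
    then obtain k where "x = 2 * k" by (elim evenE)
    then show ?thesis using 3 assms
      by (intro exI[of _ "k - 1"]) (auto simp: cycle_color_def)
  next
    case 4
    then obtain k where "x = 2 * k + 1" by (elim oddE)
    then show ?thesis using 4 assms
      by (intro exI[of _ "b - k"]) (auto simp: cycle_color_def)
  qed
qed

section \<open>The coloring of the stacked prisms\<close>

text \<open>Rows \<open>2 * k\<close> and \<open>2 * k + 1\<close> form prism \<open>k\<close>, so
  even \<open>r\<close> gives a rung and odd \<open>r\<close> an edge to the next prism.\<close>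

definition vertical_color :: "nat \<Rightarrow> nat \<Rightarrow> nat \<Rightarrow> nat" where
  "vertical_color b r j =
    (if even r then rung_color b j else low_color b j + 3) + 4 * (r div 2)"

text \<open>An edge is decoded from its extreme coordinates; columns \<open>0\<close> and \<open>b - 1\<close> are the
  ends of the wrap-around edge, which has index \<open>b - 1\<close>.\<close>

definition cylinder_coloring :: "nat \<Rightarrow> (nat \<times> nat) set \<Rightarrow> nat" where
  "cylinder_coloring b e =
    (let r = Min (fst ` e); j = Min (snd ` e); j' = Max (snd ` e) in
     if j = j' then vertical_color b r j
     else cycle_color b (if j = 0 \<and> j' = b - 1 then b - 1 else j) + 4 * (r div 2))"

lemma cylinder_coloring_vertical:
  "cylinder_coloring b (vertical_edge r j) = vertical_color b r j"
  by (simp add: cylinder_coloring_def vertical_edge_def)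

lemma cylinder_coloring_horizontal:
  assumes "b \<ge> 3" "j < b"
  shows "cylinder_coloring b (horizontal_edge b r j) = cycle_color b j + 4 * (r div 2)"
proof (cases "j + 1 = b")
  case True
  then have "j = b - 1" by simp
  then show ?thesis using assms by (simp add: cylinder_coloring_def horizontal_edge_def)
next
  case False
  \<comment> \<open>With \<open>b \<ge> 3\<close>, the edge between columns 0 and 1 is not decoded
    as the wrap-around edge.\<close>
  then have "j + 1 < b" "j = 0 \<longrightarrow> j + 1 \<noteq> b - 1" using assms by auto
  then show ?thesis by (auto simp: cylinder_coloring_def horizontal_edge_def)
qed

text \<open>Two horizontal edges and one rung fill the shifted interval \<open>{s..s + 2}\<close>.
  An edge leaving the prism extends it by one color, downwards in even rows and upwards in odd
  rows.\<close>

lemma cylinder_coloring_vertex: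
  assumes b: "b \<ge> 3" and r: "r < 2 * m" and j: "j < b"
  defines "E \<equiv> incident_edges (cylinder (2 * m) b) (r, j)"
  shows "inj_on (cylinder_coloring b) E \<and> (\<exists>l u. cylinder_coloring b ` E = {l..u})"
proof -
  let ?p = "cyclic_pred b j" and ?k = "r div 2"
  define x y z s where "x = cycle_color b ?p" and "y = cycle_color b j"
    and "z = rung_color b j" and "s = low_color b j"
  note defs = x_def y_def z_def s_def
  have xyz: "x \<noteq> y" "x \<noteq> z" "y \<noteq> z" "{x, y, z} = {s, s + 1, s + 2}"
    using prism_colors[OF b j] unfolding defs by auto
  have s: "s \<ge> 1" using low_color_bounds[OF b j] unfolding defs by simp
  have three: "x + 4 * ?k \<noteq> y + 4 * ?k" "x + 4 * ?k \<noteq> z + 4 * ?k" "y + 4 * ?k \<noteq> z + 4 * ?k"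
    using xyz by auto
  \<comment> \<open>These bounds separate the three colors from that of an edge leaving the
    prism.\<close>
  have mem: "x \<in> {s..s + 2}" "y \<in> {s..s + 2}" "z \<in> {s..s + 2}"
  proof -
    have "{x, y, z} \<subseteq> {s..s + 2}" unfolding xyz(4) by auto
    then show "x \<in> {s..s + 2}" "y \<in> {s..s + 2}" "z \<in> {s..s + 2}" by auto
  qed
  have img: "{x + 4 * ?k, y + 4 * ?k, z + 4 * ?k} = {s + 4 * ?k..s + 2 + 4 * ?k}"
  proof -
    have "{x + 4 * ?k, y + 4 * ?k, z + 4 * ?k} = (\<lambda>i. i + 4 * ?k) ` {x, y, z}" by simp
    also have "\<dots> = {s + 4 * ?k..s + 2 + 4 * ?k}" unfolding xyz(4) by auto
    finally show ?thesis .
  qed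
  have h: "cylinder_coloring b (horizontal_edge b r ?p) = x + 4 * ?k"
    "cylinder_coloring b (horizontal_edge b r j) = y + 4 * ?k"
    using b j cyclic_pred_less[OF j] by (simp_all add: cylinder_coloring_horizontal defs)
  define q where "q = r - 1"
  note E = E_def[unfolded incident_edges_cylinder[OF r j], folded q_def]
  show ?thesis
  proof (cases "even r")
    case True
    \<comment> \<open>The number of rows is even, so an even row is never the last one and its rung
      exists.\<close>
    then have r1: "r + 1 < 2 * m" using r by (elim evenE) simp
    have v: "cylinder_coloring b (vertical_edge r j) = z + 4 * ?k"
      using True by (simp add: cylinder_coloring_vertical vertical_color_def defs)
    show ?thesis
    proof (cases "r = 0")
      case True
      then have E': "E = {horizontal_edge b r ?p, horizontal_edge b r j, vertical_edge r j}"
        using E r1 by auto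
      then have "cylinder_coloring b ` E = {s + 4 * ?k..s + 2 + 4 * ?k}"
        using img by (simp add: h v)
      moreover have "inj_on (cylinder_coloring b) E"
        unfolding E' using three by (auto simp: h v)
      ultimately show ?thesis by blast
    next
      case False
      obtain l where "r = 2 * l" using \<open>even r\<close> by (elim evenE)
      with False obtain k where k: "r = 2 * k + 2" by (cases l) auto
      \<comment> \<open>The edge belongs to the preceding prism, whose shift is smaller by 4:
        \<open>s + 3 - 4 = s - 1\<close>.\<close>
      have v': "cylinder_coloring b (vertical_edge q j) = s + 4 * ?k - 1"
        by (simp add: k q_def cylinder_coloring_vertical vertical_color_def defs)
      have E': "E = {horizontal_edge b r ?p, horizontal_edge b r j, vertical_edge r j,
          vertical_edge q j}"
        using E r1 False by auto
      then have "cylinder_coloring b ` E = insert (s + 4 * ?k - 1) {s + 4 * ?k..s + 2 + 4 * ?k}"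
        unfolding img[symmetric] by (auto simp: h v v')
      also have "\<dots> = {s + 4 * ?k - 1..s + 2 + 4 * ?k}" using s by auto
      finally have "cylinder_coloring b ` E = {s + 4 * ?k - 1..s + 2 + 4 * ?k}" .
      moreover have "inj_on (cylinder_coloring b) E"
        unfolding E' using three mem s by (auto simp: h v v')
      ultimately show ?thesis by blast
    qed
  next
    case False
    then obtain k where k: "r = 2 * k + 1" by (elim oddE)
    have v: "cylinder_coloring b (vertical_edge q j) = z + 4 * ?k"
      by (simp add: k q_def cylinder_coloring_vertical vertical_color_def defs)
    have v': "cylinder_coloring b (vertical_edge r j) = s + 3 + 4 * ?k"
      by (simp add: k q_def cylinder_coloring_vertical vertical_color_def defs)
    show ?thesis
    proof (cases "r + 1 < 2 * m")
      case True
      then have E': "E = {horizontal_edge b r ?p, horizontal_edge b r j, vertical_edge q j,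
          vertical_edge r j}"
        using E k by auto
      then have "cylinder_coloring b ` E = insert (s + 3 + 4 * ?k) {s + 4 * ?k..s + 2 + 4 * ?k}"
        unfolding img[symmetric] by (auto simp: h v v')
      also have "\<dots> = {s + 4 * ?k..s + 3 + 4 * ?k}" by auto
      finally have "cylinder_coloring b ` E = {s + 4 * ?k..s + 3 + 4 * ?k}" .
      moreover have "inj_on (cylinder_coloring b) E"
        unfolding E' using three mem by (auto simp: h v v')
      ultimately show ?thesis by blast
    next
      case False
      then have E': "E = {horizontal_edge b r ?p, horizontal_edge b r j, vertical_edge q j}"
        using E k by auto
      then have "cylinder_coloring b ` E = {s + 4 * ?k..s + 2 + 4 * ?k}"
        using img by (simp add: h v)
      moreover have "inj_on (cylinder_coloring b) E"
        unfolding E' using three by (auto simp: h v)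
      ultimately show ?thesis by blast
    qed
  qed
qed

text \<open>Prism \<open>k\<close> uses all of \<open>4 * k + 1, ..., 4 * k + b + 2\<close>. These
  blocks have more than 4 colors and start 4 apart, so they leave no gap; the last one,
  \<open>k = m - 1\<close>, ends at \<open>4 * m + b - 2\<close>.\<close>

lemma cylinder_coloring_image:
  assumes b: "b \<ge> 3" and m: "m \<ge> 1"
  shows "cylinder_coloring b ` edges (cylinder (2 * m) b) = {1..4 * m + b - 2}"
proof (intro equalityI subsetI)
  fix x assume "x \<in> cylinder_coloring b ` edges (cylinder (2 * m) b)"
  then obtain e where x: "x = cylinder_coloring b e" and e: "e \<in> edges (cylinder (2 * m) b)"
    by blast
  from e[unfolded edges_cylinder] show "x \<in> {1..4 * m + b - 2}"
  proof (elim UnE CollectE exE conjE)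
    fix r j assume "e = horizontal_edge b r j" and r: "r < 2 * m" and j: "j < b"
    then have "x = cycle_color b j + 4 * (r div 2)"
      using x b by (simp add: cylinder_coloring_horizontal)
    moreover have "1 \<le> cycle_color b j" "cycle_color b j \<le> b + 2"
      using j b by (auto simp: cycle_color_def)
    moreover have "r div 2 + 1 \<le> m" using r by linarith
    ultimately show ?thesis by auto
  next
    fix r j assume "e = vertical_edge r j" and r: "r + 1 < 2 * m" and j: "j < b"
    then have x: "x = vertical_color b r j" using x by (simp add: cylinder_coloring_vertical)
    have "1 \<le> rung_color b j" "rung_color b j \<le> b + 2"
      using j b by (auto simp: rung_color_def)
    moreover have "low_color b j \<le> b" using low_color_bounds b j by simp
    moreover have "r div 2 + 1 \<le> m" using r by linarith
    \<comment> \<open>An edge between prisms needs a further prism beyond its own, which keeps the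
      extra 3 within the bound.\<close>
    moreover have "r div 2 + 2 \<le> m" if "odd r" using that r by (elim oddE) auto
    ultimately show ?thesis unfolding x vertical_color_def by auto
  qed
next
  fix x assume x: "x \<in> {1..4 * m + b - 2}"
  \<comment> \<open>The last prism whose block starts at or below \<open>x\<close>; the cap
    \<open>m - 1\<close> assigns the remaining top colors to the last prism.\<close>
  define k where "k = min ((x - 1) div 4) (m - 1)"
  define y where "y = x - 4 * k"
  have k: "k < m" using m by (simp add: k_def)
  have y: "x = y + 4 * k" "1 \<le> y" "y \<le> b + 2"
    using x m b unfolding y_def k_def by (auto simp: min_def)
  obtain j where j: "j < b" "cycle_color b j = y \<or> rung_color b j = y"
    using prism_colors_surj[OF b y(2,3)] by blast
  from j(2) show "x \<in> cylinder_coloring b ` edges (cylinder (2 * m) b)"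
  proof
    assume "cycle_color b j = y"
    then have "x = cylinder_coloring b (horizontal_edge b (2 * k) j)"
      using b j y by (simp add: cylinder_coloring_horizontal)
    moreover have "2 * k < 2 * m" using k by simp
    then have "horizontal_edge b (2 * k) j \<in> edges (cylinder (2 * m) b)"
      unfolding edges_cylinder using j by blast
    ultimately show ?thesis by blast
  next
    assume "rung_color b j = y"
    then have "x = cylinder_coloring b (vertical_edge (2 * k) j)"
      using y by (simp add: cylinder_coloring_vertical vertical_color_def)
    moreover have "2 * k + 1 < 2 * m" using k by simp
    then have "vertical_edge (2 * k) j \<in> edges (cylinder (2 * m) b)"
      unfolding edges_cylinder using j by blast
    ultimately show ?thesis by blast
  qed
qed

section \<open>From the coloring to the bound on \<open>W\<close>\<close>

lemma interval_coloring_cylinder: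
  assumes "b \<ge> 3" "m \<ge> 1"
  shows "interval_coloring (cylinder (2 * m) b) (4 * m + b - 2) (cylinder_coloring b)"
proof -
  have "verts (cylinder (2 * m) b) = {0..<2 * m} \<times> {0..<b}"
    by (simp add: cylinder_def cartesian_product_def path_graph_def cycle_graph_def)
  then show ?thesis
    unfolding interval_coloring_def
    using cylinder_coloring_image[OF assms] cylinder_coloring_vertex[OF assms(1)] by auto
qed

text \<open>One bound for cycles of either parity: \<open>b = 2 * n\<close> and
  \<open>b = 2 * n + 1\<close> yield the two halves of the theorem.\<close>

lemma W_cylinder_ge:
  assumes "b \<ge> 3" "m \<ge> 1"
  shows "interval_colorable (cylinder (2 * m) b) \<and> 4 * m + b - 2 \<le> W (cylinder (2 * m) b)"
proof -
  have t: "interval_t_colorable (cylinder (2 * m) b) (4 * m + b - 2)"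
    using interval_coloring_cylinder[OF assms] unfolding interval_t_colorable_def by blast
  moreover have "0 < 4 * m + b - 2" using assms by simp
  ultimately have c: "interval_colorable (cylinder (2 * m) b)"
    unfolding interval_colorable_def by blast
  then show ?thesis
    using W_greatest(3)[OF finite_simple_cylinder[OF assms(1)] c t] by simp
qed

theorem theorem17:
  shows "(\<forall>m n :: nat. m \<ge> 1 \<longrightarrow> n \<ge> 2 \<longrightarrow>
            interval_colorable (cylinder (2 * m) (2 * n)) \<and>
            W (cylinder (2 * m) (2 * n)) \<ge> 4 * m + 2 * n - 2) \<and>
         (\<forall>m n :: nat. m \<ge> 1 \<longrightarrow> n \<ge> 1 \<longrightarrow>
            interval_colorable (cylinder (2 * m) (2 * n + 1)) \<and>
            W (cylinder (2 * m) (2 * n + 1)) \<ge> 4 * m + 2 * n - 1)"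
proof (rule conjI; intro allI impI)
  fix m n :: nat assume "m \<ge> 1" "n \<ge> 2"
  then show "interval_colorable (cylinder (2 * m) (2 * n)) \<and>
      W (cylinder (2 * m) (2 * n)) \<ge> 4 * m + 2 * n - 2"
    using W_cylinder_ge[of "2 * n" m] by simp
next
  fix m n :: nat assume "m \<ge> 1" "n \<ge> 1"
  then show "interval_colorable (cylinder (2 * m) (2 * n + 1)) \<and>
      W (cylinder (2 * m) (2 * n + 1)) \<ge> 4 * m + 2 * n - 1"
    using W_cylinder_ge[of "2 * n + 1" m] by simp
qed

end
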